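(* Let $n \ge 4$ be an even integer and let $G$ be a finite solvable group whose character degree graph $\Delta(G)$ has exactly $n$ vertices and is $(n-2)$-regular. Let $n_1$ be an integer with $1\le n_1\le \frac n2$, and let $\Delta(G_1)$ be a character degree graph of a finite solvable group $G_1$ which is the supergraph of $\Delta(G)$, on the same $n$ vertices, obtained by adding $n_1$ new edges (each joining a pair of vertices non-adjacent in $\Delta(G)$). Then the distance Laplacian spectrum of $\Delta(G_1)$ is $$\begin{pmatrix} 0 & n+2 & n\\ 1 & \frac n2-n_1 & \left(\frac n2+n_1\right)-1\end{pmatrix}.$$
   Context: For a finite group $G$, $\mathrm{Irr}(G)$ is the set of complex irreducible characters of $G$, $\mathrm{cd}(G)=\{\chi(1) : \chi\in \mathrm{Irr}(G)\}$, and $\rho(G)$ is the set of primes dividing some element of $\mathrm{cd}(G)$. The character degree graph $\Delta(G)$ is the simple undirected graph with vertex set $\rho(G)$ in which distinct primes $p,q$ are adjacent if and only if $pq$ divides some $r\in \mathrm{cd}(G)$. Graphs are considered up to isomorphism. For a connected finite simple graph $\Gamma$ with distance matrix $\mathcal D(\Gamma)=(d_{uv})$, the transmission of a vertex $v$ is $\mathrm{Tr}(v)=\sum_{u} d_{uv}$, and the distance Laplacian is $\mathcal D^L(\Gamma)=\mathrm{Tr}(\Gamma)-\mathcal D(\Gamma)$, where $\mathrm{Tr}(\Gamma)$ is the diagonal matrix of transmissions. The distance Laplacian spectrum is the spectrum of $\mathcal D^L(\Gamma)$, displayed as a two-row array with eigenvalues in the first row and their multiplicities in the second row (an entry with multiplicity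 $0$ means that the value does not occur). *)

theory Defs
  imports
    "HOL-Algebra.Solvable_Groups"
    "HOL-Computational_Algebra.Fundamental_Theorem_Algebra"
    "Jordan_Normal_Form.VS_Connect"
    "Jordan_Normal_Form.Char_Poly"
    "Graph_Theory.Graph_Theory"
begin

section \<open>Irreducible complex characters and their degrees\<close>

text \<open>
  A representation of degree \<open>d\<close> is a homomorphism into the unit group of the ring of
  \<open>d \<times> d\<close> complex matrices, acting on column vectors.
\<close>

definition GL_complex :: "nat \<Rightarrow> complex mat monoid" where
  "GL_complex d = units_of (ring_mat TYPE(complex) d ())"

definition irreducible_representation ::
    "('a, 'b) monoid_scheme \<Rightarrow> nat \<Rightarrow> ('a \<Rightarrow> complex mat) \<Rightarrow> bool" where
  "irreducible_representation G d R \<longleftrightarrow>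
     R \<in> hom G (GL_complex d) \<and> 0 < d \<and>
     (\<forall>W. VectorSpace.subspace class_ring W (module_vec TYPE(complex) d) \<longrightarrow>
          (\<forall>g\<in>carrier G. \<forall>w\<in>W. R g *\<^sub>v w \<in> W) \<longrightarrow>
          W = {0\<^sub>v d} \<or> W = carrier_vec d)"

definition mat_trace :: "'a::comm_monoid_add mat \<Rightarrow> 'a" where
  "mat_trace A = (\<Sum>i<dim_row A. A $$ (i, i))"

definition Irr :: "('a, 'b) monoid_scheme \<Rightarrow> ('a \<Rightarrow> complex) set" where
  "Irr G = {\<lambda>g\<in>carrier G. mat_trace (R g) | R. \<exists>d. irreducible_representation G d R}"

text \<open>The values \<open>\<chi>(1)\<close> are natural numbers, and are recorded as such.\<close>

definition cd :: "('a, 'b) monoid_scheme \<Rightarrow> nat set" where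
  "cd G = {r. \<exists>\<chi>\<in>Irr G. \<chi> \<one>\<^bsub>G\<^esub> = of_nat r}"

definition degree_primes :: "('a, 'b) monoid_scheme \<Rightarrow> nat set" where
  "degree_primes G = {p. prime p \<and> (\<exists>r\<in>cd G. p dvd r)}"

section \<open>Graphs\<close>

text \<open>
  A simple undirected graph is a loop-free symmetric digraph without parallel arcs: the edge
  between \<open>u\<close> and \<open>v\<close> is the pair of arcs \<open>(u, v)\<close> and \<open>(v, u)\<close>, so that the degree of
  a vertex is its \<^const>\<open>out_degree\<close>.
\<close>

definition character_degree_graph :: "('a, 'b) monoid_scheme \<Rightarrow> nat pair_pre_digraph" where
  "character_degree_graph G =
     \<lparr>pverts = degree_primes G,
      parcs = {(p, q). p \<in> degree_primes G \<and> q \<in> degree_primes G \<and> p \<noteq> q \<and>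
                       (\<exists>r\<in>cd G. p * q dvd r)}\<rparr>"

definition nonadjacent_pairs :: "'a pair_pre_digraph \<Rightarrow> 'a set set" where
  "nonadjacent_pairs \<Gamma> =
     {{u, v} | u v. u \<in> pverts \<Gamma> \<and> v \<in> pverts \<Gamma> \<and> u \<noteq> v \<and> (u, v) \<notin> parcs \<Gamma>}"

definition add_edges :: "'a pair_pre_digraph \<Rightarrow> 'a set set \<Rightarrow> 'a pair_pre_digraph" where
  "add_edges \<Gamma> N = \<lparr>pverts = pverts \<Gamma>, parcs = parcs \<Gamma> \<union> {(u, v). {u, v} \<in> N}\<rparr>"

section \<open>The distance Laplacian\<close>

text \<open>
  Path lengths are costs with respect to the constant weight 1. The library distance is
  extended-real valued; for vertices of a connected graph it is finite.
\<close>

definition graph_dist :: "'a pair_pre_digraph \<Rightarrow> 'a \<Rightarrow> 'a \<Rightarrow> real" where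
  "graph_dist \<Gamma> u v = real_of_ereal (wf_digraph.\<mu> (with_proj \<Gamma>) (\<lambda>_. 1) u v)"

definition transmission :: "'a pair_pre_digraph \<Rightarrow> 'a \<Rightarrow> real" where
  "transmission \<Gamma> v = (\<Sum>u\<in>pverts \<Gamma>. graph_dist \<Gamma> u v)"

text \<open>Rows and columns are indexed by the vertices in increasing order.\<close>

definition distance_matrix :: "'a::linorder pair_pre_digraph \<Rightarrow> real mat" where
  "distance_matrix \<Gamma> =
     (let vs = sorted_list_of_set (pverts \<Gamma>); n = card (pverts \<Gamma>)
      in mat n n (\<lambda>(i, j). graph_dist \<Gamma> (vs ! i) (vs ! j)))"

definition transmission_matrix :: "'a::linorder pair_pre_digraph \<Rightarrow> real mat" where
  "transmission_matrix \<Gamma> =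
     (let vs = sorted_list_of_set (pverts \<Gamma>)
      in mat_diag (card (pverts \<Gamma>)) (\<lambda>i. transmission \<Gamma> (vs ! i)))"

definition distance_Laplacian :: "'a::linorder pair_pre_digraph \<Rightarrow> real mat" where
  "distance_Laplacian \<Gamma> = transmission_matrix \<Gamma> - distance_matrix \<Gamma>"

text \<open>
  The spectrum is the multiset of all complex eigenvalues, each with its multiplicity as a
  root of the characteristic polynomial.
\<close>

definition distance_Laplacian_spectrum :: "'a::linorder pair_pre_digraph \<Rightarrow> complex multiset" where
  "distance_Laplacian_spectrum \<Gamma> =
     proots (char_poly (map_mat complex_of_real (distance_Laplacian \<Gamma>)))"

end

theory Submission
  imports Defs "Jordan_Normal_Form.Schur_Decomposition"
begin

text \<open>
  An \<open>(n - 2)\<close>-regular graph on \<open>n\<close> vertices is the complement of a perfect matching, so adding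
  \<open>n\<^sub>1\<close> edges leaves the complement of a matching with \<open>k = n/2 - n\<^sub>1\<close> edges. Let \<open>\<sigma>\<close> be the
  involution exchanging matched vertices, with permutation matrix \<open>P\<close>. All distances are at
  most 2, and the distance Laplacian is \<open>M = (n + 1) I - J - P\<close> with \<open>J\<close> the all-ones matrix. If
  \<open>M v = e v\<close> and \<open>e \<noteq> 0\<close>, summing the coordinates shows that they add up to 0, hence
  \<open>P v = (n + 1 - e) v\<close> and \<open>(n + 1 - e)\<^sup>2 = 1\<close>; so every eigenvalue is 0, \<open>n\<close> or \<open>n + 2\<close>. The three
  multiplicities are then determined by the traces of \<open>I\<close>, \<open>M\<close> and \<open>M\<^sup>2\<close>.
\<close>

section \<open>Traces of powers as power sums of eigenvalues\<close>

lemma mat_trace_mult_commute: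
  fixes A B :: "'a::comm_semiring_0 mat"
  assumes "A \<in> carrier_mat n m" "B \<in> carrier_mat m n"
  shows "mat_trace (A * B) = mat_trace (B * A)"
proof -
  have "mat_trace (A * B) = (\<Sum>i<n. \<Sum>j<m. A $$ (i, j) * B $$ (j, i))"
    using assms by (auto simp: mat_trace_def scalar_prod_def atLeast0LessThan intro!: sum.cong)
  also have "\<dots> = (\<Sum>j<m. \<Sum>i<n. B $$ (j, i) * A $$ (i, j))"
    by (subst sum.swap) (simp add: mult.commute)
  also have "\<dots> = mat_trace (B * A)"
    using assms by (auto simp: mat_trace_def scalar_prod_def atLeast0LessThan intro!: sum.cong)
  finally show ?thesis .
qed

lemma mat_trace_similar:
  fixes A B :: "'a::comm_ring_1 mat"
  assumes "similar_mat_wit A B P Q"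
  shows "mat_trace A = mat_trace B"
proof -
  define n where "n = dim_row A"
  have c: "A \<in> carrier_mat n n" "B \<in> carrier_mat n n" "P \<in> carrier_mat n n" "Q \<in> carrier_mat n n"
    and QP: "Q * P = 1\<^sub>m n" and A: "A = P * B * Q"
    using similar_mat_witD[OF n_def assms] by auto
  have "mat_trace A = mat_trace (Q * (P * B))"
    unfolding A by (rule mat_trace_mult_commute) (use c in auto)
  also have "Q * (P * B) = B"
    using assoc_mult_mat[OF c(4,3,2)] QP c(2) by simp
  finally show ?thesis .
qed

lemma upper_triangular_pow:
  fixes B :: "'a::comm_semiring_1 mat"
  assumes B: "B \<in> carrier_mat n n" and tri: "upper_triangular B"
  shows "upper_triangular (B ^\<^sub>m k) \<and> (\<forall>i<n. (B ^\<^sub>m k) $$ (i, i) = B $$ (i, i) ^ k)"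
proof (induction k)
  case 0
  then show ?case using B by auto
next
  case (Suc k)
  let ?C = "B ^\<^sub>m k"
  have C: "?C \<in> carrier_mat n n" using B by simp
  have entry: "(?C * B) $$ (i, j) = (if i = j then ?C $$ (i, i) * B $$ (i, i) else 0)"
    if "i < n" "j \<le> i" for i j
  proof -
    have "(?C * B) $$ (i, j) = (\<Sum>l<n. ?C $$ (i, l) * B $$ (l, j))"
      using that B C by (simp add: scalar_prod_def atLeast0LessThan)
    \<comment> \<open>For j \<le> i only l = i survives: l < i lies below the diagonal of
      \<open>?C\<close>, and l > i \<ge> j puts (l, j) below the diagonal of
      \<open>B\<close>.\<close>
    also have "\<dots> = (\<Sum>l<n. if l = i then if i = j then ?C $$ (i, i) * B $$ (i, i) else 0 else 0)"
    proof (intro sum.cong refl)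
      fix l assume "l \<in> {..<n}"
      then consider "l < i" | "l = i" | "i < l" "l < n" by fastforce
      then show "?C $$ (i, l) * B $$ (l, j) =
          (if l = i then if i = j then ?C $$ (i, i) * B $$ (i, i) else 0 else 0)"
      proof cases
        case 1
        then show ?thesis using Suc that C by (auto simp: upper_triangular_def)
      qed (use tri that B in \<open>auto simp: upper_triangular_def\<close>)
    qed
    finally show ?thesis using that by simp
  qed
  then show ?case using Suc B C by (auto simp: upper_triangular_def mult.commute)
qed

lemma proots_prod_linear:
  fixes as :: "'a::idom list"
  shows "proots (\<Prod>a\<leftarrow>as. [:- a, 1:]) = mset as"
proof (induction as)
  case (Cons a as)
  have "(\<Prod>a\<leftarrow>as. [:- a, 1:]) \<noteq> (0 :: 'a poly)"
    by (auto simp: prod_list_zero_iff)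
  then show ?case using Cons
    by (simp only: list.map prod_list.Cons) (subst proots_mult; simp)
qed simp

text \<open>Schur's theorem makes \<open>A\<close> similar to a triangular \<open>B\<close> whose
  diagonal lists the roots of the characteristic polynomial with multiplicity. Then
  \<open>A ^\<^sub>m k\<close> is similar to \<open>B ^\<^sub>m k\<close>, which has the k-th powers
  of these roots on its diagonal. Multiplicities can thus be found from traces, without
  diagonalising.\<close>

lemma power_sum_eigenvalues:
  fixes A :: "complex mat"
  assumes A: "A \<in> carrier_mat n n"
  shows "(\<Sum>e\<in>#proots (char_poly A). e ^ k) = mat_trace (A ^\<^sub>m k)"
proof -
  obtain as where as: "char_poly A = (\<Prod>a\<leftarrow>as. [:- a, 1:])"
    using char_poly_factorized[OF A] by blast
  then obtain B P Q where wit: "similar_mat_wit A B P Q" and tri: "upper_triangular B"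
      and diag: "diag_mat B = as"
    using schur_decomposition[OF A] by (metis prod_cases3)
  have B: "B \<in> carrier_mat n n"
    using wit A by (auto simp: similar_mat_wit_def Let_def)
  have "mat_trace (A ^\<^sub>m k) = mat_trace (B ^\<^sub>m k)"
    by (rule mat_trace_similar[OF similar_mat_wit_pow[OF wit]])
  also have "\<dots> = (\<Sum>i<n. B $$ (i, i) ^ k)"
    using B upper_triangular_pow[OF B tri, of k] by (simp add: mat_trace_def)
  also have "\<dots> = (\<Sum>e\<in>#mset as. e ^ k)"
    using B by (simp add: diag[symmetric] diag_mat_def o_def sum_mset_sum_list
        interv_sum_list_conv_sum_set_nat atLeast0LessThan flip: mset_map)
  finally show ?thesis by (simp add: as proots_prod_linear)
qed

section \<open>The spectrum of (n + 1) I - J - P for an involution\<close>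

text \<open>Here \<open>k\<close> counts the two-cycles of \<tau>. Each contributes an eigenvalue -1
  of P, which turns into n + 2. The eigenvalue 1 of P has multiplicity n - k and turns into n,
  except on the all-ones vector, where J acts as n and the result is 0. The proof reaches these
  multiplicities through traces.\<close>

lemma proots_char_poly_involution:
  fixes M :: "complex mat" and \<tau> :: "nat \<Rightarrow> nat"
  assumes n: "0 < n" and M: "M \<in> carrier_mat n n"
    and entry: "\<And>i j. i < n \<Longrightarrow> j < n \<Longrightarrow>
      M $$ (i, j) = (if i = j then of_nat n + 1 else 0) - 1 - (if j = \<tau> i then 1 else 0)"
    and \<tau>: "\<And>i. i < n \<Longrightarrow> \<tau> i < n" "\<And>i. i < n \<Longrightarrow> \<tau> (\<tau> i) = i"
    and moved: "card {i. i < n \<and> \<tau> i \<noteq> i} = 2 * k"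
  shows "proots (char_poly M) =
    replicate_mset 1 0 + replicate_mset k (of_nat (n + 2)) + replicate_mset (n - 1 - k) (of_nat n)"
proof -
  let ?R = "proots (char_poly M)"
  let ?n = "of_nat n :: complex"
  define f where "f = card {i. i < n \<and> \<tau> i = i}"
  have bij: "bij_betw \<tau> {..<n} {..<n}"
    by (rule bij_betwI[where g = \<tau>]) (use \<tau> in auto)
  have eq_iff: "j = \<tau> i \<longleftrightarrow> i = \<tau> j" if "i < n" "j < n" for i j
    using \<tau> that by metis
  have nz: "char_poly M \<noteq> 0"
    using degree_monic_char_poly[OF M] by auto
  have fk: "f + 2 * k = n"
  proof -
    have "{..<n} = {i. i < n \<and> \<tau> i = i} \<union> {i. i < n \<and> \<tau> i \<noteq> i}" by auto
    then have "card {..<n} = card ({i. i < n \<and> \<tau> i = i} \<union> {i. i < n \<and> \<tau> i \<noteq> i})" by (rule arg_cong)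
    also have "\<dots> = f + 2 * k"
      unfolding f_def moved[symmetric] by (rule card_Un_disjoint) auto
    finally show ?thesis by simp
  qed
  have fix_sum: "(\<Sum>i<n. if i = \<tau> i then 1 else 0) = (of_nat f :: complex)"
  proof -
    have "{..<n} \<inter> {i. i = \<tau> i} = {i. i < n \<and> \<tau> i = i}" by auto
    then show ?thesis by (simp add: f_def sum.If_cases)
  qed

  have roots: "e \<in> {0, ?n, of_nat (n + 2)}" if "e \<in># ?R" for e
  proof (cases "e = 0")
    case False
    have "poly (char_poly M) e = 0" using that nz by simp
    then obtain v where "eigenvector M v e"
      using eigenvalue_root_char_poly[OF M] by (auto simp: eigenvalue_def)
    then have v: "v \<in> carrier_vec n" "v \<noteq> 0\<^sub>v n" and Mv: "M *\<^sub>v v = e \<cdot>\<^sub>v v"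
      using M by (auto simp: eigenvector_def)
    define S where "S = (\<Sum>j<n. v $ j)"
    have row: "e * v $ i = (?n + 1) * v $ i - S - v $ \<tau> i" if i: "i < n" for i
    proof -
      have "e * v $ i = (M *\<^sub>v v) $ i" using Mv v i by simp
      also have "\<dots> = (\<Sum>j<n. M $$ (i, j) * v $ j)"
        using M v i by (simp add: scalar_prod_def atLeast0LessThan)
      also have "\<dots> = (\<Sum>j<n. (if i = j then (?n + 1) * v $ j else 0) - v $ j - (if j = \<tau> i then v $ j else 0))"
        by (intro sum.cong refl) (auto simp: entry i algebra_simps)
      also have "\<dots> = (?n + 1) * v $ i - S - v $ \<tau> i"
        using i \<tau> by (simp add: sum_subtractf S_def)
      finally show ?thesis .
    qed
    \<comment> \<open>Adding up all rows, J contributes n S, and P contributes S because \<tau> only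
      permutes the coordinates. So e S = (n + 1) S - n S - S = 0.\<close>
    have "e * S = (\<Sum>i<n. (?n + 1) * v $ i - S - v $ \<tau> i)"
      unfolding S_def sum_distrib_left by (intro sum.cong refl) (simp add: row S_def)
    also have "\<dots> = (?n + 1) * S - ?n * S - (\<Sum>i<n. v $ \<tau> i)"
      by (simp add: sum_subtractf S_def flip: sum_distrib_left)
    also have "(\<Sum>i<n. v $ \<tau> i) = S"
      unfolding S_def by (rule sum.reindex_bij_betw[OF bij])
    finally have "S = 0" using False by (simp add: algebra_simps)
    then have step: "v $ \<tau> i = (?n + 1 - e) * v $ i" if "i < n" for i
      using row[OF that] by (simp add: algebra_simps)
    obtain i where i: "i < n" "v $ i \<noteq> 0"
      using v by (metis carrier_vecD eq_vecI index_zero_vec(1) index_zero_vec(2))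
    \<comment> \<open>\<open>step\<close> is used at i and at \<tau> i, and \<tau> (\<tau> i) = i
      closes the loop. A nonzero coordinate can then be cancelled.\<close>
    have "v $ i = (?n + 1 - e) * ((?n + 1 - e) * v $ i)"
      by (metis step \<tau> i(1))
    then have "(?n + 1 - e) ^ 2 = 1" using i(2) by (simp add: power2_eq_square)
    then have "?n + 1 - e = 1 \<or> ?n + 1 - e = -1" by (simp add: power2_eq_1_iff)
    then show ?thesis by (auto simp: algebra_simps)
  qed simp

  define a b c where "a = count ?R 0" and "b = count ?R ?n" and "c = count ?R (of_nat (n + 2))"
  \<comment> \<open>The three candidate eigenvalues are distinct, so the three counts do not
    overlap.\<close>
  have ne: "?n \<noteq> 0" "of_nat (n + 2) \<noteq> ?n" "of_nat (n + 2) \<noteq> (0 :: complex)"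
    using n by (simp_all only: of_nat_eq_iff of_nat_eq_0_iff)
  have R: "?R = replicate_mset a 0 + replicate_mset c (of_nat (n + 2)) + replicate_mset b ?n"
  proof (rule multiset_eqI)
    fix x
    show "count ?R x =
        count (replicate_mset a 0 + replicate_mset c (of_nat (n + 2)) + replicate_mset b ?n) x"
    proof (cases "x \<in># ?R")
      case True
      then have "x \<in> {0, ?n, of_nat (n + 2)}" by (rule roots)
      then show ?thesis using ne unfolding a_def b_def c_def
        by (auto simp del: count_proots of_nat_add)
    next
      case False
      then show ?thesis unfolding a_def b_def c_def
        by (auto simp del: count_proots of_nat_add simp: not_in_iff)
    qed
  qed
  \<comment> \<open>The term with \<open>0 ^ m\<close> matters at m = 0, where it equals 1 and makes
    the eigenvalue 0 count; it vanishes for larger m.\<close>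
  have pow_sum: "mat_trace (M ^\<^sub>m m) = of_nat a * 0 ^ m + of_nat c * of_nat (n + 2) ^ m + of_nat b * ?n ^ m" for m
    unfolding power_sum_eigenvalues[OF M, symmetric] R by (simp add: sum_mset_replicate_mset)

  have "mat_trace (M ^\<^sub>m 0) = ?n"
    using M by (simp add: mat_trace_def)
  then have "of_nat (a + c + b) = ?n" using pow_sum[of 0] by simp
  then have e0: "a + c + b = n" by (simp only: of_nat_eq_iff)

  have "mat_trace (M ^\<^sub>m 1) = (\<Sum>i<n. ?n - (if i = \<tau> i then 1 else 0))"
    using M by (simp add: mat_trace_def entry)
  also have "\<dots> = ?n * ?n - of_nat f"
    by (simp add: sum_subtractf fix_sum)
  finally have "of_nat (c * (n + 2) + b * n + f) = (of_nat (n * n) :: complex)"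
    using pow_sum[of 1] by (simp add: algebra_simps)
  then have e1: "c * (n + 2) + b * n + f = n * n" by (simp only: of_nat_eq_iff)

  have "mat_trace (M ^\<^sub>m 2) = mat_trace (M * M)"
    using M by (simp add: numeral_2_eq_2)
  also have "\<dots> = (\<Sum>i<n. \<Sum>j<n. M $$ (i, j) * M $$ (j, i))"
    using M by (simp add: mat_trace_def scalar_prod_def atLeast0LessThan)
  \<comment> \<open>By \<open>eq_iff\<close> the matrix is symmetric, so each summand is a squared
    entry. With the indicators x of j = i and y of j = \<tau> i, this is ((n + 1) x - 1 - y)^2.
    Since x and y are idempotent, (1 + y)^2 = 1 + 3 y, and the product x y survives only at fixed
    points.\<close>
  also have "\<dots> = (\<Sum>i<n. \<Sum>j<n. (if j = i then (?n + 1)\<^sup>2 - 2 * (?n + 1) - 2 * (?n + 1) * (if i = \<tau> i then 1 else 0) else 0)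
      + 1 + 3 * (if j = \<tau> i then 1 else 0))"
    by (intro sum.cong refl)
      (use eq_iff in \<open>auto simp: entry power2_eq_square algebra_simps\<close>)
  also have "\<dots> = (\<Sum>i<n. (?n + 1)\<^sup>2 - 2 * (?n + 1) - 2 * (?n + 1) * (if i = \<tau> i then 1 else 0) + ?n + 3)"
    using \<tau>(1) by (intro sum.cong refl) (simp add: sum.distrib flip: sum_distrib_left)
  also have "\<dots> = ?n * ((?n + 1)\<^sup>2 - 2 * (?n + 1) + ?n + 3) - 2 * (?n + 1) * of_nat f"
    by (simp add: sum.distrib sum_subtractf fix_sum algebra_simps flip: sum_distrib_left)
  finally have "of_nat (c * (n + 2)\<^sup>2 + b * n\<^sup>2 + 2 * (n + 1) * f)
      = (of_nat (n * (n\<^sup>2 + n + 2)) :: complex)"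
    using pow_sum[of 2] by (simp add: algebra_simps power2_eq_square)
  then have e2: "c * (n + 2)\<^sup>2 + b * n\<^sup>2 + 2 * (n + 1) * f = n * (n\<^sup>2 + n + 2)"
    by (rule of_nat_eq_iff[THEN iffD1])

  have i0: "int a + int c + int b = int n" using e0 by (simp flip: of_nat_add)
  have i1: "int c * (int n + 2) + int b * int n + int f = int n * int n"
    using arg_cong[OF e1, of int] by (simp add: algebra_simps)
  have i2: "int c * (int n + 2)\<^sup>2 + int b * (int n)\<^sup>2 + 2 * (int n + 1) * int f = int n * ((int n)\<^sup>2 + int n + 2)"
    using arg_cong[OF e2, of int] by (simp add: algebra_simps)
  have ik: "int f + 2 * int k = int n" using fk by linarith
  \<comment> \<open>This combination, \<open>i2\<close> minus n times \<open>i1\<close> minus n + 2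
    times \<open>ik\<close>, eliminates both b and f and leaves an equation for c - k alone.\<close>
  have "2 * (int n + 2) * (int c - int k) = 0"
  proof -
    have "2 * (int n + 2) * (int c - int k) = (int c * (int n + 2)\<^sup>2 + int b * (int n)\<^sup>2 + 2 * (int n + 1) * int f)
        - int n * (int c * (int n + 2) + int b * int n + int f) - (int n + 2) * (int f + 2 * int k)"
      by (simp add: algebra_simps power2_eq_square)
    also have "\<dots> = 0"
      unfolding i1 i2 ik by (simp add: algebra_simps power2_eq_square)
    finally show ?thesis .
  qed
  then have ck: "int c = int k" using n by simp
  have "int n * (int b - (int n - 1 - int k)) = 0"
    using i1 unfolding ck ik[symmetric] by (simp add: algebra_simps)
  then have bk: "int b = int n - 1 - int k" using n by simp
  have "a = 1" "c = k" "b = n - 1 - k" using ck bk i0 by linarith+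
  then show ?thesis by (simp only: R)
qed

section \<open>Distances and transmissions\<close>

lemma graph_dist_diameter_2:
  assumes wf: "wf_digraph (with_proj \<Gamma>)" and u: "u \<in> pverts \<Gamma>"
    and mid: "u \<noteq> v \<Longrightarrow> (u, v) \<notin> parcs \<Gamma> \<Longrightarrow> \<exists>w. (u, w) \<in> parcs \<Gamma> \<and> (w, v) \<in> parcs \<Gamma>"
  shows "graph_dist \<Gamma> u v = (if u = v then 0 else if (u, v) \<in> parcs \<Gamma> then 1 else 2)"
proof -
  interpret wf_digraph "with_proj \<Gamma>" by (rule wf)
  have cost: "awalk_cost (\<lambda>_. 1) p = real (length p)" for p
    by (simp add: awalk_cost_def sum_list_triv)
  \<comment> \<open>The distance is an infimum over all walks. A walk whose length is a lower bound
    for all the others attains it, so each case below only needs such a walk and the exclusion of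
    shorter ones.\<close>
  have dist: "graph_dist \<Gamma> u v = real d"
    if p: "awalk u p v" "length p = d" and least: "\<And>p. awalk u p v \<Longrightarrow> d \<le> length p" for p d
  proof -
    have "\<mu> (\<lambda>_. 1) u v = ereal (real d)"
      unfolding \<mu>_def cost
    proof (rule antisym)
      show "(INF p\<in>{p. awalk u p v}. ereal (real (length p))) \<le> ereal (real d)"
        by (rule INF_lower2[of p]) (use p in auto)
      show "ereal (real d) \<le> (INF p\<in>{p. awalk u p v}. ereal (real (length p)))"
        by (rule INF_greatest) (use least in auto)
    qed
    then show ?thesis by (simp add: graph_dist_def)
  qed
  consider "u = v" | "u \<noteq> v" "(u, v) \<in> parcs \<Gamma>" | w where "u \<noteq> v" "(u, v) \<notin> parcs \<Gamma>"
      "(u, w) \<in> parcs \<Gamma>" "(w, v) \<in> parcs \<Gamma>"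
    using mid by blast
  then show ?thesis
  proof cases
    case 1
    then have "awalk u [] v" using u by (simp add: awalk_Nil_iff)
    from dist[OF this] show ?thesis using 1 by simp
  next
    case 2
    then have "awalk u [(u, v)] v"
      using wellformed(2)[of "(u, v)"] by (simp add: awalk_Cons_iff awalk_Nil_iff)
    moreover have "Suc 0 \<le> length p" if "awalk u p v" for p
      using that 2 by (cases p) (auto simp: awalk_Nil_iff)
    ultimately show ?thesis using dist[of "[(u, v)]" 1] 2 by simp
  next
    case 3
    then have "awalk u [(u, w), (w, v)] v"
      using wellformed(2)[of "(w, v)"] by (simp add: awalk_Cons_iff awalk_Nil_iff)
    moreover have "2 \<le> length p" if p: "awalk u p v" for p
    proof (rule ccontr)
      assume "\<not> 2 \<le> length p"
      then consider "p = []" | e where "p = [e]"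
        by (cases p; cases "tl p") auto
      then show False
        using p 3 by cases (auto simp: awalk_Nil_iff awalk_Cons_iff)
    qed
    ultimately show ?thesis using dist[of "[(u, w), (w, v)]" 2] 3 by simp
  qed
qed

text \<open>
  The complement of \<open>\<Gamma>\<close> is a matching: the involution \<open>\<sigma>\<close> swaps the two ends of each
  missing edge and fixes the vertices that are adjacent to all others.
\<close>

definition complement_matching :: "'a pair_pre_digraph \<Rightarrow> ('a \<Rightarrow> 'a) \<Rightarrow> bool" where
  "complement_matching \<Gamma> \<sigma> \<longleftrightarrow>
     (\<forall>u v. (u, v) \<in> parcs \<Gamma> \<longleftrightarrow> u \<in> pverts \<Gamma> \<and> v \<in> pverts \<Gamma> \<and> v \<noteq> u \<and> v \<noteq> \<sigma> u) \<and>
     (\<forall>v\<in>pverts \<Gamma>. \<sigma> v \<in> pverts \<Gamma> \<and> \<sigma> (\<sigma> v) = v)"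

text \<open>Two distinct non-adjacent vertices are each other's partner. A third vertex is therefore
  the partner of neither and is adjacent to both, which gives a path of length 2.\<close>

lemma graph_dist_complement_matching:
  assumes cm: "complement_matching \<Gamma> \<sigma>" and card: "3 \<le> card (pverts \<Gamma>)"
    and u: "u \<in> pverts \<Gamma>" and v: "v \<in> pverts \<Gamma>"
  shows "graph_dist \<Gamma> u v = (if v = u then 0 else if v = \<sigma> u then 2 else 1)"
proof -
  have wf: "wf_digraph (with_proj \<Gamma>)"
    using cm by (auto simp: complement_matching_def wf_digraph_def)
  have "graph_dist \<Gamma> u v = (if u = v then 0 else if (u, v) \<in> parcs \<Gamma> then 1 else 2)"
  proof (rule graph_dist_diameter_2[OF wf u])
    assume "u \<noteq> v" and "(u, v) \<notin> parcs \<Gamma>"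
    then have \<sigma>: "\<sigma> u = v" "\<sigma> v = u" using cm u v by (auto simp: complement_matching_def)
    have "card {u, v} < card (pverts \<Gamma>)" using card \<open>u \<noteq> v\<close> by simp
    then obtain w where "w \<in> pverts \<Gamma>" "w \<noteq> u" "w \<noteq> v"
      using card_mono[of "{u, v}" "pverts \<Gamma>"] by fastforce
    moreover from this have "v \<noteq> \<sigma> w" using cm \<sigma> by (auto simp: complement_matching_def)
    ultimately show "\<exists>w. (u, w) \<in> parcs \<Gamma> \<and> (w, v) \<in> parcs \<Gamma>"
      using cm u v \<sigma> by (auto simp: complement_matching_def)
  qed
  then show ?thesis using cm u v by (auto simp: complement_matching_def)
qed

lemma transmission_complement_matching:
  assumes cm: "complement_matching \<Gamma> \<sigma>" and card: "3 \<le> card (pverts \<Gamma>)"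
    and v: "v \<in> pverts \<Gamma>"
  shows "transmission \<Gamma> v = of_nat (card (pverts \<Gamma>)) - (if v = \<sigma> v then 1 else 0)"
proof -
  have fin: "finite (pverts \<Gamma>)" using card by (auto intro: card_ge_0_finite)
  have \<sigma>v: "\<sigma> v \<in> pverts \<Gamma>" using cm v by (auto simp: complement_matching_def)
  \<comment> \<open>Every u starts with 1, and the partner of v gets 1 more. At u = v the total must
    be 0; if v is its own partner, both contributions fall there and 2 has to be removed.\<close>
  have "transmission \<Gamma> v = (\<Sum>u\<in>pverts \<Gamma>. 1 + (if u = \<sigma> v then 1 else 0)
      - (if u = v then if v = \<sigma> v then 2 else 1 else 0))"
    unfolding transmission_def
  proof (intro sum.cong refl)
    fix u assume u: "u \<in> pverts \<Gamma>"
    have "v = \<sigma> u \<longleftrightarrow> u = \<sigma> v" using cm u v by (auto simp: complement_matching_def)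
    then show "graph_dist \<Gamma> u v = 1 + (if u = \<sigma> v then 1 else 0)
      - (if u = v then if v = \<sigma> v then 2 else 1 else 0)"
      by (auto simp: graph_dist_complement_matching[OF cm card u v])
  qed
  then show ?thesis using fin v \<sigma>v by (simp add: sum.distrib sum_subtractf)
qed

section \<open>From the graph to its distance Laplacian\<close>

lemma spectrum_complement_matching:
  fixes \<Gamma> :: "'a::linorder pair_pre_digraph"
  assumes cm: "complement_matching \<Gamma> \<sigma>" and card: "card (pverts \<Gamma>) = n" and n: "3 \<le> n"
    and moved: "card {v \<in> pverts \<Gamma>. \<sigma> v \<noteq> v} = 2 * k"
  shows "distance_Laplacian_spectrum \<Gamma> =
    replicate_mset 1 0 + replicate_mset k (of_nat (n + 2)) + replicate_mset (n - 1 - k) (of_nat n)"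
proof -
  let ?V = "pverts \<Gamma>"
  define vs where "vs = sorted_list_of_set ?V"
  \<comment> \<open>The involution \<sigma> transported from vertices to matrix indices along the
    sorted enumeration \<open>vs\<close>.\<close>
  define \<tau> where "\<tau> i = the_inv_into {..<n} ((!) vs) (\<sigma> (vs ! i))" for i
  have fin: "finite ?V" using card n by (auto intro: card_ge_0_finite)
  have vs: "distinct vs" "set vs = ?V" "length vs = n"
    using fin card by (auto simp: vs_def)
  have bij: "bij_betw ((!) vs) {..<n} ?V"
    using vs by (intro bij_betw_nth) auto
  have nth: "vs ! i \<in> ?V" if "i < n" for i using bij_betwE[OF bij] that by simp
  have nth_eq: "vs ! i = vs ! j \<longleftrightarrow> i = j" if "i < n" "j < n" for i j
    using vs that by (simp add: nth_eq_iff_index_eq)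
  have \<sigma>: "\<sigma> v \<in> ?V" "\<sigma> (\<sigma> v) = v" if "v \<in> ?V" for v
    using cm that by (auto simp: complement_matching_def)
  have nth_\<tau>: "vs ! \<tau> i = \<sigma> (vs ! i)" if "i < n" for i
    unfolding \<tau>_def by (rule f_the_inv_into_f_bij_betw[OF bij]) (use \<sigma> nth that in auto)
  have \<tau>: "\<tau> i < n" if "i < n" for i
  proof -
    have "\<tau> i \<in> {..<n}" unfolding \<tau>_def
      by (rule the_inv_into_into[OF bij_betw_imp_inj_on[OF bij]])
        (use bij_betw_imp_surj_on[OF bij] \<sigma> nth that in auto)
    then show ?thesis by simp
  qed
  have \<tau>_iff: "vs ! j = \<sigma> (vs ! i) \<longleftrightarrow> j = \<tau> i" if "i < n" "j < n" for i j
    using nth_\<tau> nth_eq \<tau> that by metis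
  have dist: "graph_dist \<Gamma> (vs ! i) (vs ! j) = (if i = j then 0 else if j = \<tau> i then 2 else 1)"
    if "i < n" "j < n" for i j
    using graph_dist_complement_matching[OF cm _ nth nth] card n that nth_eq \<tau>_iff by auto
  have trans: "transmission \<Gamma> (vs ! i) = of_nat n - (if i = \<tau> i then 1 else 0)" if "i < n" for i
    using transmission_complement_matching[OF cm _ nth] card n that \<tau>_iff by simp
  define M where "M = map_mat complex_of_real (distance_Laplacian \<Gamma>)"
  have "proots (char_poly M) =
    replicate_mset 1 0 + replicate_mset k (of_nat (n + 2)) + replicate_mset (n - 1 - k) (of_nat n)"
  proof (rule proots_char_poly_involution[where \<tau> = \<tau>])
    show "0 < n" using n by simp
    show "M \<in> carrier_mat n n"
      by (auto simp: M_def distance_Laplacian_def distance_matrix_def transmission_matrix_def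
          mat_diag_def card Let_def)
    \<comment> \<open>On the diagonal stands the transmission, n or, at a fixed point, n - 1. Off
      the diagonal the negated distance is -1, or -2 for partners. One formula covers both because n
      = (n + 1) - 1.\<close>
    show "M $$ (i, j) = (if i = j then of_nat n + 1 else 0) - 1 - (if j = \<tau> i then 1 else 0)"
      if "i < n" "j < n" for i j
      using that dist trans
      by (auto simp: M_def distance_Laplacian_def distance_matrix_def transmission_matrix_def
          mat_diag_def card Let_def simp flip: vs_def)
    show "\<tau> i < n" if "i < n" for i by (rule \<tau>[OF that])
    show "\<tau> (\<tau> i) = i" if "i < n" for i
    proof -
      have "vs ! \<tau> (\<tau> i) = vs ! i" by (simp add: nth_\<tau> \<tau> \<sigma> nth that)
      then show ?thesis using nth_eq \<tau> that by blast
    qed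
    have "bij_betw ((!) vs) {i. i < n \<and> \<tau> i \<noteq> i} {v \<in> ?V. \<sigma> v \<noteq> v}"
    proof (rule bij_betw_subset[OF bij])
      show "(!) vs ` {i. i < n \<and> \<tau> i \<noteq> i} = {v \<in> ?V. \<sigma> v \<noteq> v}"
      proof safe
        fix v assume "v \<in> ?V" "\<sigma> v \<noteq> v"
        moreover from this obtain i where "i < n" "v = vs ! i"
          using bij by (auto simp: bij_betw_def)
        ultimately show "v \<in> (!) vs ` {i. i < n \<and> \<tau> i \<noteq> i}"
          using nth_\<tau>[of i] by (intro image_eqI[of _ _ i]) auto
      next
        fix i assume "i < n" "\<tau> i \<noteq> i" "\<sigma> (vs ! i) = vs ! i"
        then show False using \<tau>_iff[of i i] by simp
      qed (use nth in auto)
    qed auto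
    from bij_betw_same_card[OF this] show "card {i. i < n \<and> \<tau> i \<noteq> i} = 2 * k"
      by (simp only: moved)
  qed
  then show ?thesis by (simp add: distance_Laplacian_spectrum_def M_def)
qed

section \<open>Regularity, added edges and isomorphism\<close>

text \<open>Of the n - 1 other vertices, n - 2 are neighbours, so each vertex misses exactly one;
  this is its image under \<sigma>. As adjacency is symmetric, the missed vertex misses it in
  return.\<close>

lemma complement_matching_regular:
  assumes sym: "\<And>u v. (u, v) \<in> parcs \<Gamma> \<Longrightarrow> (v, u) \<in> parcs \<Gamma>"
    and simple: "\<And>u v. (u, v) \<in> parcs \<Gamma> \<Longrightarrow> u \<in> pverts \<Gamma> \<and> u \<noteq> v"
    and card: "card (pverts \<Gamma>) = n" and n: "2 \<le> n"
    and reg: "\<forall>v\<in>pverts \<Gamma>. out_degree (with_proj \<Gamma>) v = n - 2"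
  obtains \<sigma> where "complement_matching \<Gamma> \<sigma>" "\<And>v. v \<in> pverts \<Gamma> \<Longrightarrow> \<sigma> v \<noteq> v"
proof -
  let ?V = "pverts \<Gamma>"
  define C where "C v = {w \<in> ?V. w \<noteq> v \<and> (v, w) \<notin> parcs \<Gamma>}" for v
  have fin: "finite ?V" using card n by (auto intro: card_ge_0_finite)
  have C1: "card (C v) = 1" if v: "v \<in> ?V" for v
  proof -
    let ?A = "{w. (v, w) \<in> parcs \<Gamma>}"
    have A: "?A \<subseteq> ?V - {v}" using sym simple by blast
    have "card ?A = card (Pair v ` ?A)" by (simp add: card_image inj_on_def)
    also have "Pair v ` ?A = out_arcs (with_proj \<Gamma>) v" by (auto simp: out_arcs_def)
    also have "card \<dots> = n - 2" using reg v by (simp add: out_degree_def)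
    finally have "card ?A = n - 2" .
    moreover have "C v = (?V - {v}) - ?A" by (auto simp: C_def)
    ultimately show ?thesis
      using card n v fin A by (simp add: card_Diff_subset finite_subset)
  qed
  define \<sigma> where "\<sigma> v = the_elem (C v)" for v
  have C: "C v = {\<sigma> v}" if v: "v \<in> ?V" for v
  proof -
    obtain x where "C v = {x}" using C1[OF v] by (rule card_1_singletonE)
    then show ?thesis by (simp add: \<sigma>_def)
  qed
  have iff: "w = \<sigma> v \<longleftrightarrow> w \<in> ?V \<and> w \<noteq> v \<and> (v, w) \<notin> parcs \<Gamma>" if "v \<in> ?V" for v w
  proof -
    have "w = \<sigma> v \<longleftrightarrow> w \<in> C v" by (simp add: C[OF that])
    then show ?thesis by (simp add: C_def)
  qed
  have \<sigma>: "\<sigma> v \<in> ?V" "\<sigma> v \<noteq> v" "(v, \<sigma> v) \<notin> parcs \<Gamma>" if "v \<in> ?V" for v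
    using iff[OF that, of "\<sigma> v"] by auto
  have "v = \<sigma> (\<sigma> v)" if "v \<in> ?V" for v
    using \<sigma>[OF that] that sym by (intro iff[THEN iffD2]) auto
  moreover have "(u, v) \<in> parcs \<Gamma> \<longleftrightarrow> u \<in> ?V \<and> v \<in> ?V \<and> v \<noteq> u \<and> v \<noteq> \<sigma> u" for u v
    using iff[of u v] sym simple by blast
  ultimately have "complement_matching \<Gamma> \<sigma>"
    using \<sigma>(1) by (simp add: complement_matching_def)
  then show thesis using that \<sigma>(2) by blast
qed

text \<open>Every new edge joins a vertex to its partner, so adding it just turns both of its ends
  into fixed points.\<close>

lemma complement_matching_add_edges:
  assumes cm: "complement_matching \<Gamma> \<sigma>" and N: "N \<subseteq> nonadjacent_pairs \<Gamma>"
  shows "complement_matching (add_edges \<Gamma> N) (\<lambda>v. if {v, \<sigma> v} \<in> N then v else \<sigma> v)"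
proof -
  have N_pair: "u \<in> pverts \<Gamma> \<and> v \<in> pverts \<Gamma> \<and> u \<noteq> v \<and> v = \<sigma> u" if uv: "{u, v} \<in> N" for u v
  proof -
    obtain a b where "{u, v} = {a, b}" "a \<in> pverts \<Gamma>" "b \<in> pverts \<Gamma>" "a \<noteq> b" "(a, b) \<notin> parcs \<Gamma>"
      using uv N unfolding nonadjacent_pairs_def by blast
    moreover from this have "b = \<sigma> a" "a = \<sigma> b"
      using cm by (auto simp: complement_matching_def)
    ultimately show ?thesis by (metis doubleton_eq_iff)
  qed
  have swap: "{\<sigma> v, v} = {v, \<sigma> v}" for v by auto
  show ?thesis
    unfolding complement_matching_def
  proof (intro conjI allI ballI)
    fix u v
    show "(u, v) \<in> parcs (add_edges \<Gamma> N) \<longleftrightarrow>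
        u \<in> pverts (add_edges \<Gamma> N) \<and> v \<in> pverts (add_edges \<Gamma> N) \<and> v \<noteq> u \<and>
        v \<noteq> (if {u, \<sigma> u} \<in> N then u else \<sigma> u)"
    proof (cases "{u, v} \<in> N")
      case True
      from N_pair[OF this] show ?thesis using True by (auto simp: add_edges_def)
    next
      case False
      then show ?thesis using cm by (auto simp: add_edges_def complement_matching_def)
    qed
  qed (use cm in \<open>auto simp: add_edges_def complement_matching_def swap\<close>)
qed

text \<open>The vertices that become fixed are those covered by \<open>N\<close>. Its members are
  orbits of \<sigma>, hence pairwise disjoint, and have two elements because \<sigma> moves every
  vertex.\<close>

lemma card_moved_add_edges:
  assumes cm: "complement_matching \<Gamma> \<sigma>" and moved: "\<And>v. v \<in> pverts \<Gamma> \<Longrightarrow> \<sigma> v \<noteq> v"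
    and fin: "finite (pverts \<Gamma>)" and N: "N \<subseteq> nonadjacent_pairs \<Gamma>"
  shows "card {v \<in> pverts \<Gamma>. (if {v, \<sigma> v} \<in> N then v else \<sigma> v) \<noteq> v} = card (pverts \<Gamma>) - 2 * card N"
proof -
  have pair: "\<exists>v\<in>pverts \<Gamma>. e = {v, \<sigma> v}" if "e \<in> N" for e
    using that N cm by (fastforce simp: nonadjacent_pairs_def complement_matching_def)
  have sub: "\<Union>N \<subseteq> pverts \<Gamma>"
    using pair cm by (fastforce simp: complement_matching_def)
  have in_pair: "e = {v, \<sigma> v}" if "e \<in> N" "v \<in> e" for e v
    using pair[OF that(1)] that(2) cm by (auto simp: complement_matching_def)
  have "card (\<Union>N) = (\<Sum>e\<in>N. card e)"
  proof (rule card_Union_disjoint)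
    show "pairwise disjnt N"
    proof (rule pairwiseI)
      fix e e' assume "e \<in> N" "e' \<in> N" "e \<noteq> e'"
      then show "disjnt e e'" using in_pair unfolding disjnt_iff by metis
    qed
    show "finite e" if "e \<in> N" for e using pair[OF that] by auto
  qed
  also have "\<dots> = (\<Sum>e\<in>N. 2)"
  proof (intro sum.cong refl)
    fix e assume "e \<in> N"
    then obtain v where "v \<in> pverts \<Gamma>" "e = {v, \<sigma> v}" using pair by blast
    then show "card e = 2" using moved[of v] by (simp add: card_2_iff)
  qed
  finally have "card (\<Union>N) = 2 * card N" by simp
  moreover have "v \<in> \<Union>N \<longleftrightarrow> {v, \<sigma> v} \<in> N" for v
    using in_pair by (metis UnionE UnionI insertI1)
  then have "{v \<in> pverts \<Gamma>. (if {v, \<sigma> v} \<in> N then v else \<sigma> v) \<noteq> v} = pverts \<Gamma> - \<Union>N"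
    using moved by auto
  ultimately show ?thesis
    using sub fin by (simp add: card_Diff_subset finite_subset)
qed

text \<open>The graph of \<open>G1\<close> has its own set of primes and matches the enlarged graph
  only up to isomorphism. Conjugating \<sigma> by the vertex bijection carries over everything that
  determines the spectrum.\<close>

lemma complement_matching_iso:
  assumes cm: "complement_matching \<Gamma> \<sigma>" and iso: "digraph_iso (with_proj \<Gamma>) (with_proj \<Delta>)"
  obtains \<sigma>' where "complement_matching \<Delta> \<sigma>'" "card (pverts \<Delta>) = card (pverts \<Gamma>)"
    "card {v \<in> pverts \<Delta>. \<sigma>' v \<noteq> v} = card {v \<in> pverts \<Gamma>. \<sigma> v \<noteq> v}"
proof -
  obtain h where h: "pre_digraph.digraph_isomorphism (with_proj \<Gamma>) h"
    and \<Delta>: "with_proj \<Delta> = app_iso h (with_proj \<Gamma>)"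
    using iso by (auto simp: digraph_iso_def)
  define f where "f = iso_verts h"
  let ?g = "the_inv_into (pverts \<Gamma>) f"
  define \<sigma>' where "\<sigma>' v = f (\<sigma> (?g v))" for v
  have V: "pverts \<Delta> = f ` pverts \<Gamma>"
    using arg_cong[OF \<Delta>, of verts] by (simp add: f_def)
  have inj: "inj_on f (pverts \<Gamma>)"
    using pre_digraph.digraph_isomorphism_inj_on_verts[OF h] by (simp add: f_def)
  have wf: "wf_digraph (with_proj \<Gamma>)"
    using h by (simp add: pre_digraph.digraph_isomorphism_def)
  \<comment> \<open>An isomorphism may relabel arcs independently of vertices. Comparing
    \<open>arcs_ends\<close> removes that freedom, since in these graphs an arc is the pair of its
    ends.\<close>
  have A: "parcs \<Delta> = (\<lambda>(u, v). (f u, f v)) ` parcs \<Gamma>"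
    using arg_cong[OF \<Delta>, of arcs_ends] wf_digraph.arcs_ends_app_iso_eq[OF wf h]
    by (simp add: f_def)
  have \<sigma>: "\<sigma> v \<in> pverts \<Gamma>" "\<sigma> (\<sigma> v) = v" if "v \<in> pverts \<Gamma>" for v
    using cm that by (auto simp: complement_matching_def)
  have f_eq: "f u = f v \<longleftrightarrow> u = v" if "u \<in> pverts \<Gamma>" "v \<in> pverts \<Gamma>" for u v
    using inj that by (auto dest: inj_onD)
  have \<sigma>'f: "\<sigma>' (f v) = f (\<sigma> v)" if "v \<in> pverts \<Gamma>" for v
    using that by (simp add: \<sigma>'_def the_inv_into_f_f[OF inj])
  have arc: "(f u, f v) \<in> parcs \<Delta> \<longleftrightarrow> (u, v) \<in> parcs \<Gamma>"
    if "u \<in> pverts \<Gamma>" "v \<in> pverts \<Gamma>" for u v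
  proof
    assume "(f u, f v) \<in> parcs \<Delta>"
    then obtain a b where ab: "(a, b) \<in> parcs \<Gamma>" "f a = f u" "f b = f v" by (auto simp: A)
    moreover from ab(1) have "a \<in> pverts \<Gamma>" "b \<in> pverts \<Gamma>"
      using cm by (auto simp: complement_matching_def)
    ultimately show "(u, v) \<in> parcs \<Gamma>" using that f_eq by simp
  qed (auto simp: A)
  have arcs_verts: "u \<in> pverts \<Delta> \<and> v \<in> pverts \<Delta>" if "(u, v) \<in> parcs \<Delta>" for u v
    using that cm unfolding A V by (auto simp: complement_matching_def)
  have "complement_matching \<Delta> \<sigma>'"
    unfolding complement_matching_def
  proof (intro conjI allI ballI)
    fix u v
    show "(u, v) \<in> parcs \<Delta> \<longleftrightarrow> u \<in> pverts \<Delta> \<and> v \<in> pverts \<Delta> \<and> v \<noteq> u \<and> v \<noteq> \<sigma>' u"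
    proof (cases "u \<in> pverts \<Delta> \<and> v \<in> pverts \<Delta>")
      case True
      then obtain a b where "a \<in> pverts \<Gamma>" "b \<in> pverts \<Gamma>" "u = f a" "v = f b" by (auto simp: V)
      then show ?thesis
        using True cm by (simp add: arc \<sigma>'f f_eq \<sigma>) (simp add: complement_matching_def)
    qed (use arcs_verts in blast)
  qed (auto simp: V \<sigma>'f \<sigma>)
  moreover have "card (pverts \<Delta>) = card (pverts \<Gamma>)"
    by (simp add: V card_image inj)
  moreover have "{v \<in> pverts \<Delta>. \<sigma>' v \<noteq> v} = f ` {v \<in> pverts \<Gamma>. \<sigma> v \<noteq> v}"
    by (auto simp: V \<sigma>'f f_eq \<sigma>)
  then have "card {v \<in> pverts \<Delta>. \<sigma>' v \<noteq> v} = card {v \<in> pverts \<Gamma>. \<sigma> v \<noteq> v}"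
    using inj by (simp add: card_image inj_on_def)
  ultimately show thesis by (rule that)
qed

section \<open>The spectrum after adding edges\<close>

theorem corollary3p9:
  fixes G :: "('a, 'c) monoid_scheme" and G1 :: "('b, 'd) monoid_scheme"
    and n n1 :: nat and N :: "nat set set"
  assumes "4 \<le> n" and "even n"
    and "group G" and "finite (carrier G)" and "solvable G"
    and "card (pverts (character_degree_graph G)) = n"
    and "\<forall>v \<in> pverts (character_degree_graph G).
           out_degree (with_proj (character_degree_graph G)) v = n - 2"
    and "1 \<le> n1" and "n1 \<le> n div 2"
    and "group G1" and "finite (carrier G1)" and "solvable G1"
    and "N \<subseteq> nonadjacent_pairs (character_degree_graph G)" and "card N = n1"
    and "digraph_iso (with_proj (add_edges (character_degree_graph G) N))
           (with_proj (character_degree_graph G1))"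
  shows "distance_Laplacian_spectrum (character_degree_graph G1) =
           replicate_mset 1 0
         + replicate_mset (n div 2 - n1) (of_nat (n + 2))
         + replicate_mset (n div 2 + n1 - 1) (of_nat n)"
proof -
  let ?\<Gamma> = "character_degree_graph G" and ?\<Delta> = "character_degree_graph G1"
  have fin: "finite (pverts ?\<Gamma>)"
    using assms(1,6) by (auto intro: card_ge_0_finite)
  obtain \<sigma> where cm: "complement_matching ?\<Gamma> \<sigma>"
    and moved: "\<And>v. v \<in> pverts ?\<Gamma> \<Longrightarrow> \<sigma> v \<noteq> v"
  proof (rule complement_matching_regular)
    show "\<forall>v\<in>pverts ?\<Gamma>. out_degree (with_proj ?\<Gamma>) v = n - 2" by (rule assms(7))
    show "card (pverts ?\<Gamma>) = n" by (rule assms(6))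
    show "2 \<le> n" using assms(1) by simp
  qed (auto simp: character_degree_graph_def mult.commute)
  define \<sigma>1 where "\<sigma>1 v = (if {v, \<sigma> v} \<in> N then v else \<sigma> v)" for v
  have cm1: "complement_matching (add_edges ?\<Gamma> N) \<sigma>1"
    unfolding \<sigma>1_def by (rule complement_matching_add_edges[OF cm assms(13)])
  have "card {v \<in> pverts ?\<Gamma>. \<sigma>1 v \<noteq> v} = n - 2 * n1"
    unfolding \<sigma>1_def using card_moved_add_edges[OF cm moved fin assms(13)] assms(6,14) by simp
  then have card1: "card {v \<in> pverts (add_edges ?\<Gamma> N). \<sigma>1 v \<noteq> v} = 2 * (n div 2 - n1)"
    using \<open>even n\<close> by (simp add: add_edges_def diff_mult_distrib2)
  obtain \<sigma>2 where "complement_matching ?\<Delta> \<sigma>2"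
    and "card (pverts ?\<Delta>) = card (pverts (add_edges ?\<Gamma> N))"
    and "card {v \<in> pverts ?\<Delta>. \<sigma>2 v \<noteq> v} = card {v \<in> pverts (add_edges ?\<Gamma> N). \<sigma>1 v \<noteq> v}"
    by (rule complement_matching_iso[OF cm1 assms(15)])
  then have "distance_Laplacian_spectrum ?\<Delta> =
    replicate_mset 1 0 + replicate_mset (n div 2 - n1) (of_nat (n + 2))
      + replicate_mset (n - 1 - (n div 2 - n1)) (of_nat n)"
    using assms(1,6) card1 by (intro spectrum_complement_matching) (auto simp: add_edges_def)
  \<comment> \<open>As n1 \<le> n / 2, the inner subtraction of natural numbers is not
    truncated.\<close>
  moreover have "n - 1 - (n div 2 - n1) = n div 2 + n1 - 1"
    using \<open>even n\<close> assms(1,9) by (auto elim!: evenE)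
  ultimately show ?thesis by simp
qed

end
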